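(* Let $-\infty<m<M<\infty$. Let $E$ be a non-empty set, let $L$ be a vector space of real-valued functions on $E$ satisfying (L1) and (L2), and let $A\colon L\to\mathbb{R}$ be any positive linear functional with $A(\boldsymbol{1})=1$. Let $\phi$ be a $3$-convex function defined on an interval $I\subseteq\mathbb{R}$ whose interior contains $[m,M]$, and suppose $\phi$ is differentiable on $(m,M)$. Then $$(M-A(f))\left[\phi_-'(M)-\frac{\phi(M)-\phi(m)}{M-m}\right]-\frac{\phi_-''(M)}{2}A\big[(M\boldsymbol{1}-f)^2\big]$$ $$\le \frac{M-A(f)}{M-m}\phi(m)+\frac{A(f)-m}{M-m}\phi(M)-A(\phi(f))$$ $$\le (A(f)-m)\left[\frac{\phi(M)-\phi(m)}{M-m}-\phi_+'(m)\right]-\frac{\phi_+''(m)}{2}A\big[(f-m\boldsymbol{1})^2\big]$$ holds for any $f\in L$ such that $\phi\circ f\in L$ and $m\le f(t)\le M$ for $t\in E$. If the function $-\phi$ is $3$-convex, then the inequalities are reversed.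
   Context: Conditions on $L$: (L1) $f,g\in L$ implies $af+bg\in L$ for all $a,b\in\mathbb{R}$; (L2) the constant function $\boldsymbol{1}$ (with $\boldsymbol{1}(t)=1$ for all $t\in E$) belongs to $L$. A positive linear functional $A\colon L\to\mathbb{R}$ satisfies $A(af+bg)=aA(f)+bA(g)$ for $f,g\in L$, $a,b\in\mathbb{R}$, and $A(f)\ge 0$ whenever $f\in L$ and $f(t)\ge 0$ for every $t\in E$. Divided differences: for mutually distinct points $t_0,\dots,t_n$, $[t_i]\phi=\phi(t_i)$ and $[t_0,\dots,t_n]\phi=\dfrac{[t_1,\dots,t_n]\phi-[t_0,\dots,t_{n-1}]\phi}{t_n-t_0}$. A function $\phi$ on an interval $I$ is $3$-convex if $[t_0,t_1,t_2,t_3]\phi\ge 0$ for all choices of four distinct points $t_0,t_1,t_2,t_3\in I$. $\phi(f)$ denotes $\phi\circ f$; $\phi_+'$ and $\phi_-'$ denote the right and left first derivatives of $\phi$, and $\phi_+''(m)$ and $\phi_-''(M)$ denote the right second derivative of $\phi$ at $m$ and the left second derivative of $\phi$ at $M$. *)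

theory Defs
  imports "HOL-Analysis.Analysis"
begin

text \<open>
  Real functions on a set \<open>E\<close> are represented by their extensional representatives
  (\<open>undefined\<close> outside \<open>E\<close>), so that equality of representatives is equality on \<open>E\<close>.
\<close>

definition function_space :: "'e set \<Rightarrow> ('e \<Rightarrow> real) set \<Rightarrow> bool" where
  "function_space E L \<longleftrightarrow>
     L \<subseteq> extensional E \<and>
     (\<forall>f\<in>L. \<forall>g\<in>L. \<forall>a b. (\<lambda>t\<in>E. a * f t + b * g t) \<in> L) \<and>
     (\<lambda>t\<in>E. 1) \<in> L"

definition positive_linear_functional ::
    "'e set \<Rightarrow> ('e \<Rightarrow> real) set \<Rightarrow> (('e \<Rightarrow> real) \<Rightarrow> real) \<Rightarrow> bool" where
  "positive_linear_functional E L A \<longleftrightarrow>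
     (\<forall>f\<in>L. \<forall>g\<in>L. \<forall>a b. A (\<lambda>t\<in>E. a * f t + b * g t) = a * A f + b * A g) \<and>
     (\<forall>f\<in>L. (\<forall>t\<in>E. 0 \<le> f t) \<longrightarrow> 0 \<le> A f)"

text \<open>The value at the empty list is a dummy.\<close>

fun divided_difference :: "(real \<Rightarrow> real) \<Rightarrow> real list \<Rightarrow> real" where
  "divided_difference \<phi> [] = 0"
| "divided_difference \<phi> [t] = \<phi> t"
| "divided_difference \<phi> (t # u # ts) =
     (divided_difference \<phi> (u # ts) - divided_difference \<phi> (butlast (t # u # ts)))
       / (last (u # ts) - t)"

definition three_convex_on :: "real set \<Rightarrow> (real \<Rightarrow> real) \<Rightarrow> bool" where
  "three_convex_on I \<phi> \<longleftrightarrow>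
     (\<forall>t0\<in>I. \<forall>t1\<in>I. \<forall>t2\<in>I. \<forall>t3\<in>I.
        distinct [t0, t1, t2, t3] \<longrightarrow> 0 \<le> divided_difference \<phi> [t0, t1, t2, t3])"

definition right_deriv :: "(real \<Rightarrow> real) \<Rightarrow> real \<Rightarrow> real" where
  "right_deriv \<phi> x = vector_derivative \<phi> (at_right x)"

definition left_deriv :: "(real \<Rightarrow> real) \<Rightarrow> real \<Rightarrow> real" where
  "left_deriv \<phi> x = vector_derivative \<phi> (at_left x)"

text \<open>
  One-sided second derivatives are iterated one-sided derivatives, not limits of
  second-order difference quotients. Where \<open>\<phi>\<close> is differentiable, the inner one-sided
  derivative is the ordinary derivative.
\<close>

definition right_deriv2 :: "(real \<Rightarrow> real) \<Rightarrow> real \<Rightarrow> real" where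
  "right_deriv2 \<phi> x = right_deriv (right_deriv \<phi>) x"

definition left_deriv2 :: "(real \<Rightarrow> real) \<Rightarrow> real \<Rightarrow> real" where
  "left_deriv2 \<phi> x = left_deriv (left_deriv \<phi>) x"

end

theory Submission
  imports Defs
begin

text \<open>
  The middle term compares \<open>A (\<phi> \<circ> f)\<close> with the value at \<open>A f\<close> of the chord of \<open>\<phi>\<close>
  through \<open>m\<close> and \<open>M\<close>. Written from its left end that value is
  \<open>\<phi> m + s (A f - m)\<close>, and from its right end it is \<open>\<phi> M - s (M - A f)\<close>, where \<open>s\<close> is the
  slope of the chord. In the upper bound, respectively the lower bound, the terms with \<open>s\<close>
  therefore cancel, and what remains is the functional \<open>A\<close> applied to one of the two one-sided
  Taylor inequalities
  \<open>\<phi> x \<ge> \<phi> m + \<phi>' m (x - m) + \<phi>''\<^sub>+ m / 2 (x - m)\<^sup>2\<close> and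
  \<open>\<phi> x \<le> \<phi> M - \<phi>' M (M - x) + \<phi>''\<^sub>- M / 2 (M - x)\<^sup>2\<close>
  for \<open>m \<le> x \<le> M\<close>, at \<open>x = f t\<close>.

  Both Taylor inequalities hold because the derivative of a \<open>3\<close>-convex function is convex in the
  interior of \<open>I\<close>: a convex function lies above its one-sided tangents, so
  \<open>\<phi>' y \<ge> \<phi>' a + C (y - a)\<close> on the appropriate side of \<open>a\<close>, where \<open>C\<close> is the one-sided
  derivative of \<open>\<phi>'\<close> at \<open>a\<close>, and integrating from \<open>a\<close> to \<open>x\<close> gives the claim; going leftwards
  the sign flips, which is why the two inequalities have opposite directions.

  The regularity of \<open>\<phi>\<close> comes from divided differences alone. Third-order divided
  differences of \<open>\<phi>\<close> with a node \<open>a\<close> are second-order divided differences of the slope function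
  \<open>q t = (\<phi> t - \<phi> a) / (t - a)\<close> on the punctured domain
  (\<open>divided_difference_slope\<close>). Hence \<open>q\<close> is Lipschitz around \<open>a\<close> and has a
  limit there, which is \<open>\<phi>' a\<close> (\<open>three_convex_on_has_derivative\<close>). Convexity of \<open>\<phi>'\<close>
  (\<open>three_convex_on_deriv_two_convex_on\<close>) is the identity
  \<open>[x,y,z]\<phi>' = [x,x,y,z]\<phi> + [x,y,y,z]\<phi> + [x,y,z,z]\<phi>\<close>, in which a repeated node
  stands for the limit of distinct nodes.

  If \<open>- \<phi>\<close> is \<open>3\<close>-convex, the same inequalities hold for \<open>- \<phi>\<close>. The one-sided
  derivatives are choice-defined and commute with negation only where they exist, so their
  behaviour under negation is proved along with the Taylor inequalities.
\<close>

section \<open>Functions with nonnegative second divided differences\<close>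

text \<open>
  Convexity in terms of divided differences. Unlike \<^const>\<open>convex_on\<close> it makes sense on a
  domain that is not convex, such as an interval with one point removed, and there it also
  constrains triples of points on both sides of the gap.
\<close>

definition two_convex_on :: "real set \<Rightarrow> (real \<Rightarrow> real) \<Rightarrow> bool" where
  "two_convex_on J g \<longleftrightarrow>
     (\<forall>x\<in>J. \<forall>y\<in>J. \<forall>z\<in>J. distinct [x, y, z] \<longrightarrow> 0 \<le> divided_difference g [x, y, z])"

lemma two_convex_on_slope_le:
  assumes "two_convex_on J g" "x \<in> J" "y \<in> J" "z \<in> J" "y \<noteq> x" "y \<noteq> z" "x < z"
  shows "(g y - g x) / (y - x) \<le> (g z - g y) / (z - y)"
proof -
  have "0 \<le> divided_difference g [x, y, z]"
    using assms unfolding two_convex_on_def by auto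
  then show ?thesis
    using assms by (simp add: zero_le_divide_iff)
qed

text \<open>
  The point \<open>a\<close> may lie anywhere relative to \<open>y\<close> and \<open>z\<close>. Choosing \<open>y\<close> and \<open>z\<close> on opposite
  sides of \<open>a\<close> makes the slopes on one side bounded by a slope on the other, so that the one-sided
  derivatives below are finite.
\<close>

lemma two_convex_on_secant_mono:
  assumes "two_convex_on J g" "a \<in> J" "y \<in> J" "z \<in> J" "y \<noteq> a" "z \<noteq> a" "y \<le> z"
  shows "(g y - g a) / (y - a) \<le> (g z - g a) / (z - a)"
proof (cases "y = z")
  case False
  have "(g y - g a) / (y - a) = (g a - g y) / (a - y)"
    by (metis minus_diff_eq minus_divide_divide)
  then show ?thesis
    using two_convex_on_slope_le[of J g y a z] assms False by simp
qed simp

text \<open>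
  The secant slopes at \<open>a\<close> increase in \<open>y\<close> and, since \<open>J\<close> is open, are bounded below by a
  secant slope to a point left of \<open>a\<close>. Their infimum is the right derivative.
\<close>

lemma two_convex_on_right_tangent:
  assumes g: "two_convex_on J g" and J: "open J" and a: "a \<in> J"
  obtains C where "(g has_real_derivative C) (at_right a)"
    "\<And>y. y \<in> J \<Longrightarrow> a \<le> y \<Longrightarrow> g a + C * (y - a) \<le> g y"
proof -
  define q where "q y = (g y - g a) / (y - a)" for y
  note mono = two_convex_on_secant_mono[OF g a, folded q_def]
  obtain e where e: "e > 0" "cball a e \<subseteq> J"
    using J a unfolding open_contains_cball by auto
  then have p: "a - e \<in> J" by (auto simp: dist_real_def subset_iff)
  have lb: "q (a - e) \<le> q y" if "y \<in> J" "a < y" for y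
    using mono[OF p] that e by simp
  define C where "C = Inf (q ` ({a<..} \<inter> J))"
  have "(q \<longlongrightarrow> C) (at a within ({a<..} \<inter> J))"
    unfolding C_def by (rule Lim_right_bound) (use mono lb in auto)
  moreover have "at a within ({a<..} \<inter> J) = at_right a"
    by (rule at_within_nhd[OF a J]) auto
  ultimately have "(g has_real_derivative C) (at_right a)"
    by (simp add: has_field_derivative_iff q_def[abs_def])
  moreover have "g a + C * (y - a) \<le> g y" if y: "y \<in> J" "a \<le> y" for y
  proof (cases "y = a")
    case False
    have "C \<le> q y"
      unfolding C_def using y False lb by (intro cInf_lower bdd_belowI) auto
    then show ?thesis
      using y False by (simp add: q_def field_simps)
  qed simp
  ultimately show thesis using that by blast
qed

text \<open>
  Here the supremum of the secant slopes is the derivative; since \<open>y - a \<le> 0\<close>, an upper bound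
  of the slope again gives a lower bound of \<open>g y\<close>.
\<close>

lemma two_convex_on_left_tangent:
  assumes g: "two_convex_on J g" and J: "open J" and a: "a \<in> J"
  obtains C where "(g has_real_derivative C) (at_left a)"
    "\<And>y. y \<in> J \<Longrightarrow> y \<le> a \<Longrightarrow> g a + C * (y - a) \<le> g y"
proof -
  define q where "q y = (g y - g a) / (y - a)" for y
  note mono = two_convex_on_secant_mono[OF g a, folded q_def]
  obtain e where e: "e > 0" "cball a e \<subseteq> J"
    using J a unfolding open_contains_cball by auto
  then have p: "a + e \<in> J" by (auto simp: dist_real_def subset_iff)
  have ub: "q y \<le> q (a + e)" if "y \<in> J" "y < a" for y
    using mono[OF _ p] that e by simp
  define C where "C = Sup (q ` ({..<a} \<inter> J))"
  have "(q \<longlongrightarrow> C) (at a within ({..<a} \<inter> J))"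
    unfolding C_def by (rule Lim_left_bound) (use mono ub in auto)
  moreover have "at a within ({..<a} \<inter> J) = at_left a"
    by (rule at_within_nhd[OF a J]) auto
  ultimately have "(g has_real_derivative C) (at_left a)"
    by (simp add: has_field_derivative_iff q_def[abs_def])
  moreover have "g a + C * (y - a) \<le> g y" if y: "y \<in> J" "y \<le> a" for y
  proof (cases "y = a")
    case False
    have "q y \<le> C"
      unfolding C_def using y False ub by (intro cSup_upper bdd_aboveI) auto
    then show ?thesis
      using y False by (simp add: q_def field_simps)
  qed simp
  ultimately show thesis using that by blast
qed

text \<open>
  Slopes of chords near \<open>a\<close> are squeezed between the slope of one chord further left and that
  of one chord further right. So \<open>q\<close> is Lipschitz on a punctured neighbourhood and
  extends continuously to \<open>a\<close>. The left and right limits agree because the chords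
  may pass over the missing point.
\<close>

lemma two_convex_on_punctured_limit:
  assumes q: "two_convex_on (I - {a}) q" and a: "a \<in> interior I"
  obtains l where "(q \<longlongrightarrow> l) (at a)"
proof -
  obtain e where e: "e > 0" "cball a e \<subseteq> I"
    using a unfolding mem_interior_cball by auto
  define r where "r = e / 2"
  have r: "r > 0" using e by (simp add: r_def)
  have I: "x \<in> I" if "\<bar>x - a\<bar> \<le> 2 * r" for x
    using that e by (auto simp: dist_real_def r_def abs_minus_commute subset_iff)
  define X where "X = {a - r<..<a + r} - {a}"
  define k1 where "k1 = (q (a - r) - q (a - 2 * r)) / r"
  define k2 where "k2 = (q (a + 2 * r) - q (a + r)) / r"
  define K where "K = max \<bar>k1\<bar> \<bar>k2\<bar>"
  have bound: "\<bar>q y - q x\<bar> \<le> K * (y - x)" if "x \<in> X" "y \<in> X" "x < y" for x y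
  proof -
    note sl = two_convex_on_slope_le[OF q]
    have m: "a - 2 * r \<in> I - {a}" "a - r \<in> I - {a}" "a + r \<in> I - {a}" "a + 2 * r \<in> I - {a}"
       "x \<in> I - {a}" "y \<in> I - {a}"
      using that r by (auto simp: X_def intro!: I)
    have xy: "a - r < x" "y < a + r" using that by (auto simp: X_def)
    have "k1 \<le> (q x - q (a - r)) / (x - (a - r))"
      using sl[OF m(1,2,5)] r xy by (simp add: k1_def)
    also have "\<dots> \<le> (q y - q x) / (y - x)"
      using sl[OF m(2,5,6)] that r xy by simp
    finally have 1: "k1 \<le> (q y - q x) / (y - x)" .
    have "(q y - q x) / (y - x) \<le> (q (a + r) - q y) / (a + r - y)"
      using sl[OF m(5,6,3)] that r xy by simp
    also have "\<dots> \<le> k2"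
      using sl[OF m(6,3,4)] that r xy by (simp add: k2_def)
    finally have "\<bar>(q y - q x) / (y - x)\<bar> \<le> K"
      using 1 unfolding K_def by linarith
    then show ?thesis using \<open>x < y\<close> by (simp add: divide_simps)
  qed
  have "dist (q x) (q y) \<le> K * dist x y" if "x \<in> X" "y \<in> X" for x y
    using bound[of x y] bound[of y x] that by (cases x y rule: linorder_cases) (auto simp: dist_real_def)
  then have "K-lipschitz_on X q"
    by (intro lipschitz_onI) (auto simp: K_def)
  then have "uniformly_continuous_on X q"
    by (rule lipschitz_on_uniformly_continuous)
  moreover have within: "at a within X = at a"
  proof -
    have "at a within X = at a within {a - r<..<a + r}"
      by (simp add: X_def at_within_def)
    also have "\<dots> = at a"
      by (rule at_within_open) (use r in auto)
    finally show ?thesis .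
  qed
  then have "a \<in> closure X"
    by (metis UnCI closure_def mem_Collect_eq trivial_limit_at trivial_limit_within)
  ultimately obtain l where "(q \<longlongrightarrow> l) (at a within X)"
    by (rule uniformly_continuous_on_extension_at_closure)
  with that within show thesis by simp
qed

section \<open>Derivatives of functions that are \<open>3\<close>-convex\<close>

text \<open>
  Dividing out the node \<open>a\<close> first instead of last gives the same value: this is the symmetry of
  divided differences in their nodes, for four nodes and the recursion given here.
\<close>

lemma divided_difference_slope:
  assumes "distinct [a, x, y, z]"
  shows "divided_difference \<phi> [a, x, y, z]
           = divided_difference (\<lambda>t. (\<phi> t - \<phi> a) / (t - a)) [x, y, z]"
proof -
  define q where "q t = (\<phi> t - \<phi> a) / (t - a)" for t
  define S where "S = (q y - q x) / (y - x)"
  define T where "T = (q z - q y) / (z - y)"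
  have ne: "x \<noteq> a" "y \<noteq> a" "z \<noteq> a" "y \<noteq> x" "z \<noteq> x" "z \<noteq> y"
    using assms by auto
  have ph: "\<phi> t = \<phi> a + q t * (t - a)" if "t \<noteq> a" for t
    using that by (simp add: q_def)
  have qy: "q y = q x + S * (y - x)" and qz: "q z = q y + T * (z - y)"
    using ne by (simp_all add: S_def T_def)
  have ax: "(\<phi> x - \<phi> a) / (x - a) = q x"
    by (simp add: q_def)
  have xy: "(\<phi> y - \<phi> x) / (y - x) = q x + (y - a) * S"
    using ne by (simp add: ph qy field_simps)
  have yz: "(\<phi> z - \<phi> y) / (z - y) = q x + (z - a) * T + (y - x) * S"
    using ne by (simp add: ph qz qy field_simps)
  have "divided_difference \<phi> [a, x, y, z] = (T - S) / (z - x)"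
  proof -
    have "(q x + (y - a) * S - q x) / (y - a) = S"
      using ne by simp
    moreover have "(q x + (z - a) * T + (y - x) * S - (q x + (y - a) * S)) / (z - x)
                     = S + (z - a) * ((T - S) / (z - x))"
      using ne by (simp add: field_simps)
    ultimately show ?thesis
      using ne by (simp add: ax xy yz)
  qed
  then show ?thesis
    using ne by (simp add: S_def T_def q_def)
qed

lemma three_convex_on_imp_slope_two_convex_on:
  assumes "three_convex_on I \<phi>" "a \<in> I"
  shows "two_convex_on (I - {a}) (\<lambda>t. (\<phi> t - \<phi> a) / (t - a))"
  unfolding two_convex_on_def
proof (intro ballI impI)
  fix x y z assume *: "x \<in> I - {a}" "y \<in> I - {a}" "z \<in> I - {a}" "distinct [x, y, z]"
  then have "0 \<le> divided_difference \<phi> [a, x, y, z]"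
    using assms unfolding three_convex_on_def by auto
  also have "\<dots> = divided_difference (\<lambda>t. (\<phi> t - \<phi> a) / (t - a)) [x, y, z]"
    by (rule divided_difference_slope) (use * in auto)
  finally show "0 \<le> divided_difference (\<lambda>t. (\<phi> t - \<phi> a) / (t - a)) [x, y, z]" .
qed

lemma three_convex_on_has_derivative:
  assumes "three_convex_on I \<phi>" "a \<in> interior I"
  shows "(\<phi> has_real_derivative deriv \<phi> a) (at a)"
proof -
  have "a \<in> I" using assms interior_subset by auto
  then obtain l where "((\<lambda>t. (\<phi> t - \<phi> a) / (t - a)) \<longlongrightarrow> l) (at a)"
    using two_convex_on_punctured_limit three_convex_on_imp_slope_two_convex_on assms by metis
  then have "(\<phi> has_real_derivative l) (at a)"
    by (simp add: has_field_derivative_iff)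
  then show ?thesis by (metis DERIV_imp_deriv)
qed

text \<open>
  The bound says that \<open>[x,x,y,z]\<phi>\<close> is nonnegative. With \<open>q\<close> the slope function at \<open>x\<close>,
  it is the limit of \<open>[y,t,z]q\<close> as \<open>t\<close> tends to \<open>x\<close>, because \<open>q t\<close> tends to \<open>\<phi>' x\<close>.
\<close>

lemma three_convex_on_double_node:
  assumes \<phi>: "three_convex_on I \<phi>" and x: "x \<in> interior I" and I: "y \<in> I" "z \<in> I"
    and ne: "distinct [x, y, z]"
  shows "0 \<le> (((\<phi> z - \<phi> x) / (z - x) - deriv \<phi> x) / (z - x)
             - ((\<phi> y - \<phi> x) / (y - x) - deriv \<phi> x) / (y - x)) / (z - y)"
proof -
  define q where "q t = (\<phi> t - \<phi> x) / (t - x)" for t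
  have xI: "x \<in> I" using x interior_subset by auto
  have lim: "(q \<longlongrightarrow> deriv \<phi> x) (at x)"
    using three_convex_on_has_derivative[OF \<phi> x] by (simp add: has_field_derivative_iff q_def[abs_def])
  have "((\<lambda>t. divided_difference q [y, t, z]) \<longlongrightarrow>
      ((q z - deriv \<phi> x) / (z - x) - (deriv \<phi> x - q y) / (x - y)) / (z - y)) (at x)"
    using ne by (auto intro!: tendsto_intros lim)
  moreover have "eventually (\<lambda>t. t \<in> I \<and> t \<noteq> x \<and> t \<noteq> y \<and> t \<noteq> z) (at x)"
  proof -
    have "eventually (\<lambda>t. t \<in> interior I - {y, z}) (at x)"
      using x ne by (intro eventually_at_in_open') (auto intro: open_delete)
    moreover have "eventually (\<lambda>t. t \<noteq> x) (at x)"
      by (rule eventually_neq_at_within)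
    ultimately show ?thesis
      by eventually_elim (use interior_subset in auto)
  qed
  then have "eventually (\<lambda>t. 0 \<le> divided_difference q [y, t, z]) (at x)"
  proof eventually_elim
    case (elim t)
    show ?case
      using three_convex_on_imp_slope_two_convex_on[OF \<phi> xI] elim I ne
      unfolding two_convex_on_def q_def[abs_def, symmetric] by auto
  qed
  ultimately have "0 \<le> ((q z - deriv \<phi> x) / (z - x) - (deriv \<phi> x - q y) / (x - y)) / (z - y)"
    by (rule tendsto_lowerbound) simp
  moreover have "(deriv \<phi> x - q y) / (x - y) = (q y - deriv \<phi> x) / (y - x)"
    by (metis minus_diff_eq minus_divide_divide)
  ultimately show ?thesis by (simp add: q_def)
qed

text \<open>
  Differentiating along the diagonal doubles each node in turn:
  \<open>[x,y,z]\<phi>' = [x,x,y,z]\<phi> + [x,y,y,z]\<phi> + [x,y,z,z]\<phi>\<close>.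
\<close>

lemma three_convex_on_deriv_two_convex_on:
  assumes \<phi>: "three_convex_on I \<phi>"
  shows "two_convex_on (interior I) (deriv \<phi>)"
  unfolding two_convex_on_def
proof (intro ballI impI)
  fix x y z assume I: "x \<in> interior I" "y \<in> interior I" "z \<in> interior I"
    and ne': "distinct [x, y, z]"
  then have I': "x \<in> I" "y \<in> I" "z \<in> I" using interior_subset by auto
  have ne: "y \<noteq> x" "z \<noteq> x" "z \<noteq> y" using ne' by auto
  define s where "s = (\<phi> y - \<phi> x) / (y - x)"
  define u where "u = (\<phi> z - \<phi> x) / (z - x)"
  define w where "w = (\<phi> z - \<phi> y) / (z - y)"
  \<comment> \<open>The three instances of the double-node lemma orient the same three slopes differently.\<close>
  have swap: "(\<phi> x - \<phi> y) / (x - y) = s" "(\<phi> x - \<phi> z) / (x - z) = u" "(\<phi> y - \<phi> z) / (y - z) = w"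
    unfolding s_def u_def w_def by (metis minus_diff_eq minus_divide_divide)+
  \<comment> \<open>The slopes satisfy one linear relation, without which the identity below fails.\<close>
  have "w * (z - y) = u * (z - x) - s * (y - x)"
    using ne by (simp add: s_def u_def w_def)
  then have w: "w = (u * (z - x) - s * (y - x)) / (z - y)"
    using ne by (simp add: field_simps)
  have "0 \<le> ((u - deriv \<phi> x) / (z - x) - (s - deriv \<phi> x) / (y - x)) / (z - y)"
    using three_convex_on_double_node[OF \<phi> I(1) I'(2,3)] ne by (simp add: s_def u_def)
  moreover have "0 \<le> ((w - deriv \<phi> y) / (z - y) - (s - deriv \<phi> y) / (x - y)) / (z - x)"
    using three_convex_on_double_node[OF \<phi> I(2) I'(1,3)] ne unfolding swap by (simp add: w_def)
  moreover have "0 \<le> ((w - deriv \<phi> z) / (y - z) - (u - deriv \<phi> z) / (x - z)) / (y - x)"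
    using three_convex_on_double_node[OF \<phi> I(3) I'(1,2)] ne unfolding swap by simp
  moreover have "divided_difference (deriv \<phi>) [x, y, z] =
      ((u - deriv \<phi> x) / (z - x) - (s - deriv \<phi> x) / (y - x)) / (z - y)
    + ((w - deriv \<phi> y) / (z - y) - (s - deriv \<phi> y) / (x - y)) / (z - x)
    + ((w - deriv \<phi> z) / (y - z) - (u - deriv \<phi> z) / (x - z)) / (y - x)"
  proof -
    \<comment> \<open>Increments in place of nodes keep the rational identity small.\<close>
    define h k where "h = y - x" and "k = z - y"
    have hk: "y = x + h" "z = x + h + k" by (simp_all add: h_def k_def)
    have "h \<noteq> 0" "k \<noteq> 0" "h + k \<noteq> 0" using ne by (auto simp: h_def k_def)
    then show ?thesis
      unfolding w hk
      by (simp add: divide_simps) (simp add: algebra_simps)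
  qed
  ultimately show "0 \<le> divided_difference (deriv \<phi>) [x, y, z]"
    by (simp only: add_nonneg_nonneg)
qed


section \<open>One-sided derivatives and Taylor inequalities\<close>

lemma right_deriv_eqI: "(\<phi> has_real_derivative D) (at_right x) \<Longrightarrow> right_deriv \<phi> x = D"
  unfolding right_deriv_def has_real_derivative_iff_has_vector_derivative
  by (rule vector_derivative_within) simp

lemma left_deriv_eqI: "(\<phi> has_real_derivative D) (at_left x) \<Longrightarrow> left_deriv \<phi> x = D"
  unfolding left_deriv_def has_real_derivative_iff_has_vector_derivative
  by (rule vector_derivative_within) simp

text \<open>
  The inner one-sided derivative has to be identified on a whole neighbourhood of \<open>a\<close> before the
  outer one can be computed, hence the open set \<open>J\<close>.
\<close>

lemma right_derivs_eqI:
  assumes J: "open J" "a \<in> J"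
    and d: "\<And>x. x \<in> J \<Longrightarrow> (\<phi> has_real_derivative d x) (at x)"
    and C: "(d has_real_derivative C) (at_right a)"
  shows "right_deriv \<phi> a = d a" "right_deriv2 \<phi> a = C"
proof -
  have eq: "right_deriv \<phi> x = d x" if "x \<in> J" for x
    using d[OF that] by (intro right_deriv_eqI) (rule has_field_derivative_at_within)
  then show "right_deriv \<phi> a = d a" using J by simp
  have "eventually (\<lambda>x. x \<in> J) (at_right a)"
    using J by (metis eventually_at_topological)
  then have "eventually (\<lambda>x. right_deriv \<phi> x = d x) (at_right a)"
    by eventually_elim (rule eq)
  then have "(right_deriv \<phi> has_real_derivative C) (at_right a)"
    using C eq[OF J(2)] by (subst has_field_derivative_cong_eventually)
  then show "right_deriv2 \<phi> a = C"
    unfolding right_deriv2_def by (rule right_deriv_eqI)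
qed

lemma left_derivs_eqI:
  assumes J: "open J" "a \<in> J"
    and d: "\<And>x. x \<in> J \<Longrightarrow> (\<phi> has_real_derivative d x) (at x)"
    and C: "(d has_real_derivative C) (at_left a)"
  shows "left_deriv \<phi> a = d a" "left_deriv2 \<phi> a = C"
proof -
  have eq: "left_deriv \<phi> x = d x" if "x \<in> J" for x
    using d[OF that] by (intro left_deriv_eqI) (rule has_field_derivative_at_within)
  then show "left_deriv \<phi> a = d a" using J by simp
  have "eventually (\<lambda>x. x \<in> J) (at_left a)"
    using J by (metis eventually_at_topological)
  then have "eventually (\<lambda>x. left_deriv \<phi> x = d x) (at_left a)"
    by eventually_elim (rule eq)
  then have "(left_deriv \<phi> has_real_derivative C) (at_left a)"
    using C eq[OF J(2)] by (subst has_field_derivative_cong_eventually)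
  then show "left_deriv2 \<phi> a = C"
    unfolding left_deriv2_def by (rule left_deriv_eqI)
qed

text \<open>
  The Taylor remainder has a nonnegative derivative. It vanishes at \<open>a\<close>, so \<open>p = a\<close> gives a
  lower bound of \<open>\<phi>\<close> to the right of \<open>a\<close>, and \<open>r = a\<close> an upper bound to the left.
\<close>

lemma deriv_bound_imp_taylor_mono:
  fixes \<phi> d :: "real \<Rightarrow> real"
  assumes "p \<le> r"
    and d: "\<And>y. y \<in> {p..r} \<Longrightarrow> (\<phi> has_real_derivative d y) (at y)"
    and b: "\<And>y. y \<in> {p..r} \<Longrightarrow> D + C * (y - a) \<le> d y"
  shows "\<phi> p - D * (p - a) - C / 2 * (p - a)\<^sup>2 \<le> \<phi> r - D * (r - a) - C / 2 * (r - a)\<^sup>2"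
proof (rule DERIV_nonneg_imp_nondecreasing[OF \<open>p \<le> r\<close>])
  fix y assume "p \<le> y" "y \<le> r"
  then have y: "y \<in> {p..r}" by simp
  have "((\<lambda>y. \<phi> y - D * (y - a) - C / 2 * (y - a)\<^sup>2) has_real_derivative
          d y - D - C * (y - a)) (at y)"
    by (auto intro!: derivative_eq_intros d[OF y])
  then show "\<exists>z. ((\<lambda>y. \<phi> y - D * (y - a) - C / 2 * (y - a)\<^sup>2) has_real_derivative z) (at y) \<and> 0 \<le> z"
    using b[OF y] by (intro exI conjI) auto
qed

text \<open>
  The last two conclusions need the existence of the derivatives and therefore \<open>3\<close>-convexity;
  they serve to transfer the inequality to functions whose negative is \<open>3\<close>-convex.
\<close>

lemma three_convex_on_taylor_right:
  assumes \<phi>: "three_convex_on I \<phi>" and I: "{a..x} \<subseteq> interior I" and "a \<le> x"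
  shows "\<phi> a + right_deriv \<phi> a * (x - a) + right_deriv2 \<phi> a / 2 * (x - a)\<^sup>2 \<le> \<phi> x"
    and "right_deriv (\<lambda>x. - \<phi> x) a = - right_deriv \<phi> a"
    and "right_deriv2 (\<lambda>x. - \<phi> x) a = - right_deriv2 \<phi> a"
proof -
  let ?J = "interior I"
  have J: "open ?J" "a \<in> ?J" using I \<open>a \<le> x\<close> by auto
  note d = three_convex_on_has_derivative[OF \<phi>]
  obtain C where C: "(deriv \<phi> has_real_derivative C) (at_right a)"
    and tangent: "\<And>y. y \<in> ?J \<Longrightarrow> a \<le> y \<Longrightarrow> deriv \<phi> a + C * (y - a) \<le> deriv \<phi> y"
    using two_convex_on_right_tangent[OF three_convex_on_deriv_two_convex_on[OF \<phi>] J] by blast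
  have eq: "right_deriv \<phi> a = deriv \<phi> a" "right_deriv2 \<phi> a = C"
    using right_derivs_eqI[OF J _ C] d by blast+
  show "\<phi> a + right_deriv \<phi> a * (x - a) + right_deriv2 \<phi> a / 2 * (x - a)\<^sup>2 \<le> \<phi> x"
    using deriv_bound_imp_taylor_mono[OF \<open>a \<le> x\<close>, of \<phi> "deriv \<phi>" "deriv \<phi> a" C a] d I tangent
    unfolding eq by (auto simp: subset_iff)
  show "right_deriv (\<lambda>x. - \<phi> x) a = - right_deriv \<phi> a"
    and "right_deriv2 (\<lambda>x. - \<phi> x) a = - right_deriv2 \<phi> a"
    unfolding eq using right_derivs_eqI[OF J _ DERIV_minus[OF C], of "\<lambda>x. - \<phi> x"] DERIV_minus[OF d]
    by blast+
qed

lemma three_convex_on_taylor_left: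
  assumes \<phi>: "three_convex_on I \<phi>" and I: "{x..a} \<subseteq> interior I" and "x \<le> a"
  shows "\<phi> x \<le> \<phi> a - left_deriv \<phi> a * (a - x) + left_deriv2 \<phi> a / 2 * (a - x)\<^sup>2"
    and "left_deriv (\<lambda>x. - \<phi> x) a = - left_deriv \<phi> a"
    and "left_deriv2 (\<lambda>x. - \<phi> x) a = - left_deriv2 \<phi> a"
proof -
  let ?J = "interior I"
  have J: "open ?J" "a \<in> ?J" using I \<open>x \<le> a\<close> by auto
  note d = three_convex_on_has_derivative[OF \<phi>]
  obtain C where C: "(deriv \<phi> has_real_derivative C) (at_left a)"
    and tangent: "\<And>y. y \<in> ?J \<Longrightarrow> y \<le> a \<Longrightarrow> deriv \<phi> a + C * (y - a) \<le> deriv \<phi> y"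
    using two_convex_on_left_tangent[OF three_convex_on_deriv_two_convex_on[OF \<phi>] J] by blast
  have eq: "left_deriv \<phi> a = deriv \<phi> a" "left_deriv2 \<phi> a = C"
    using left_derivs_eqI[OF J _ C] d by blast+
  have "\<phi> x \<le> \<phi> a + deriv \<phi> a * (x - a) + C / 2 * (x - a)\<^sup>2"
    using deriv_bound_imp_taylor_mono[OF \<open>x \<le> a\<close>, of \<phi> "deriv \<phi>" "deriv \<phi> a" C a] d I tangent
    by (auto simp: subset_iff)
  then show "\<phi> x \<le> \<phi> a - left_deriv \<phi> a * (a - x) + left_deriv2 \<phi> a / 2 * (a - x)\<^sup>2"
    unfolding eq by (simp add: power2_commute[of x a] algebra_simps)
  show "left_deriv (\<lambda>x. - \<phi> x) a = - left_deriv \<phi> a"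
    and "left_deriv2 (\<lambda>x. - \<phi> x) a = - left_deriv2 \<phi> a"
    unfolding eq using left_derivs_eqI[OF J _ DERIV_minus[OF C], of "\<lambda>x. - \<phi> x"] DERIV_minus[OF d]
    by blast+
qed

section \<open>Positive functionals and the two-sided estimate\<close>

text \<open>
  Positivity is only assumed for members of \<open>L\<close>, so the combination has to be built inside \<open>L\<close> from
  binary ones; the constant \<open>a\<close> enters through \<open>A \<one> = 1\<close>.
\<close>

lemma positive_functional_combination_nonneg:
  assumes L: "function_space E L" and A: "positive_linear_functional E L A"
    and one: "A (\<lambda>t\<in>E. 1) = 1" and fgh: "f \<in> L" "g \<in> L" "h \<in> L"
    and nonneg: "\<And>t. t \<in> E \<Longrightarrow> 0 \<le> a + b * f t + c * g t + d * h t"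
  shows "0 \<le> a + b * A f + c * A g + d * A h"
proof -
  have lin: "(\<lambda>t\<in>E. a * f t + b * g t) \<in> L"
    "A (\<lambda>t\<in>E. a * f t + b * g t) = a * A f + b * A g" if "f \<in> L" "g \<in> L" for f g a b
    using L A that unfolding function_space_def positive_linear_functional_def by auto
  define e where "e = (\<lambda>t\<in>E. 1 :: real)"
  define u where "u = (\<lambda>t\<in>E. a * e t + b * f t)"
  define v where "v = (\<lambda>t\<in>E. c * g t + d * h t)"
  define w where "w = (\<lambda>t\<in>E. 1 * u t + 1 * v t)"
  have "e \<in> L" "A e = 1" using L one by (simp_all add: e_def function_space_def)
  then have uv: "u \<in> L" "v \<in> L" and A_uv: "A u = a + b * A f" "A v = c * A g + d * A h"
    using lin fgh by (simp_all add: u_def v_def)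
  then have "w \<in> L" "A w = a + b * A f + c * A g + d * A h"
    using lin[OF uv, of 1 1] by (simp_all add: w_def)
  moreover have "\<forall>t\<in>E. 0 \<le> w t"
    using nonneg by (auto simp: w_def u_def v_def e_def add.assoc)
  ultimately show ?thesis
    using A unfolding positive_linear_functional_def by metis
qed

theorem theorem2p3:
  fixes m M :: real and I :: "real set" and \<phi> :: "real \<Rightarrow> real"
    and E :: "'e set" and L :: "('e \<Rightarrow> real) set"
    and A :: "('e \<Rightarrow> real) \<Rightarrow> real" and f :: "'e \<Rightarrow> real"
  assumes "m < M"
    and "E \<noteq> {}"
    and "function_space E L"
    and "positive_linear_functional E L A"
    and "A (\<lambda>t\<in>E. 1) = 1"
    and "is_interval I" and "{m..M} \<subseteq> interior I"
    and "\<phi> differentiable_on {m<..<M}"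
    and "f \<in> L"
    and "(\<lambda>t\<in>E. \<phi> (f t)) \<in> L"
    and "(\<lambda>t\<in>E. (M - f t)\<^sup>2) \<in> L"
    and "(\<lambda>t\<in>E. (f t - m)\<^sup>2) \<in> L"
    and "\<forall>t\<in>E. m \<le> f t \<and> f t \<le> M"
  shows
    "let lower = (M - A f) * (left_deriv \<phi> M - (\<phi> M - \<phi> m) / (M - m))
                   - left_deriv2 \<phi> M / 2 * A (\<lambda>t\<in>E. (M - f t)\<^sup>2);
         middle = (M - A f) / (M - m) * \<phi> m + (A f - m) / (M - m) * \<phi> M
                   - A (\<lambda>t\<in>E. \<phi> (f t));
         upper = (A f - m) * ((\<phi> M - \<phi> m) / (M - m) - right_deriv \<phi> m)
                   - right_deriv2 \<phi> m / 2 * A (\<lambda>t\<in>E. (f t - m)\<^sup>2)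
     in (three_convex_on I \<phi> \<longrightarrow> lower \<le> middle \<and> middle \<le> upper) \<and>
        (three_convex_on I (\<lambda>x. - \<phi> x) \<longrightarrow> upper \<le> middle \<and> middle \<le> lower)"
proof -
  define B where "B = A (\<lambda>t\<in>E. \<phi> (f t))"
  define Q where "Q = A (\<lambda>t\<in>E. (M - f t)\<^sup>2)"
  define R where "R = A (\<lambda>t\<in>E. (f t - m)\<^sup>2)"
  define D D' where "D = right_deriv \<phi> m" and "D' = left_deriv \<phi> M"
  define C C' where "C = right_deriv2 \<phi> m" and "C' = left_deriv2 \<phi> M"
  have range: "m \<le> f t" "f t \<le> M" "{m..f t} \<subseteq> interior I" "{f t..M} \<subseteq> interior I" if "t \<in> E" for t
    using assms(7,13) that by (auto simp: subset_iff)
  have MI: "{m..m} \<subseteq> interior I" "{M..M} \<subseteq> interior I"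
    using assms(1,7) by auto
  note comb = positive_functional_combination_nonneg[OF assms(3-5,9,10)]
  note combR = comb[OF assms(12), folded B_def R_def] and combQ = comb[OF assms(11), folded B_def Q_def]

  \<comment> \<open>The sign \<open>c\<close> is \<open>1\<close> for \<open>\<phi>\<close> \<open>3\<close>-convex and \<open>-1\<close> for \<open>- \<phi>\<close> \<open>3\<close>-convex.\<close>
  have right: "0 \<le> c * (B - (\<phi> m + D * (A f - m) + C / 2 * R))"
    if "\<And>t. t \<in> E \<Longrightarrow> 0 \<le> c * (\<phi> (f t) - (\<phi> m + D * (f t - m) + C / 2 * (f t - m)\<^sup>2))" for c
    using combR[of "c * (D * m - \<phi> m)" "- c * D" c "- c * C / 2"] that by (simp add: algebra_simps)
  have left: "0 \<le> c * (\<phi> M - D' * (M - A f) + C' / 2 * Q - B)"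
    if "\<And>t. t \<in> E \<Longrightarrow> 0 \<le> c * (\<phi> M - D' * (M - f t) + C' / 2 * (M - f t)\<^sup>2 - \<phi> (f t))" for c
    using combQ[of "c * (\<phi> M - D' * M)" "c * D'" "- c" "c * C' / 2"] that by (simp add: algebra_simps)

  have convex: "\<phi> m + D * (A f - m) + C / 2 * R \<le> B \<and> B \<le> \<phi> M - D' * (M - A f) + C' / 2 * Q"
    if "three_convex_on I \<phi>"
    using right[of 1] left[of 1] three_convex_on_taylor_right(1)[OF that range(3,1)]
      three_convex_on_taylor_left(1)[OF that range(4,2)]
    unfolding D_def D'_def C_def C'_def by simp
  have concave: "B \<le> \<phi> m + D * (A f - m) + C / 2 * R \<and> \<phi> M - D' * (M - A f) + C' / 2 * Q \<le> B"
    if neg: "three_convex_on I (\<lambda>x. - \<phi> x)"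
  proof -
    have D: "right_deriv (\<lambda>x. - \<phi> x) m = - D" "right_deriv2 (\<lambda>x. - \<phi> x) m = - C"
      "left_deriv (\<lambda>x. - \<phi> x) M = - D'" "left_deriv2 (\<lambda>x. - \<phi> x) M = - C'"
      using three_convex_on_taylor_right(2,3)[OF neg MI(1)]
        three_convex_on_taylor_left(2,3)[OF neg MI(2)]
      unfolding D_def D'_def C_def C'_def by simp_all
    show ?thesis
      using right[of "-1"] left[of "-1"] three_convex_on_taylor_right(1)[OF neg range(3,1)]
        three_convex_on_taylor_left(1)[OF neg range(4,2)]
      unfolding D by (simp add: algebra_simps)
  qed

  define s where "s = (\<phi> M - \<phi> m) / (M - m)"
  have M: "\<phi> M = \<phi> m + s * (M - m)"
    using assms(1) by (simp add: s_def)
  have chord: "(M - A f) / (M - m) * \<phi> m + (A f - m) / (M - m) * \<phi> M = \<phi> m + (A f - m) * s"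
    unfolding M using assms(1) by (simp add: divide_simps) (simp add: algebra_simps)
  show ?thesis
    using convex concave M
    unfolding Let_def s_def[symmetric] B_def[symmetric] Q_def[symmetric] R_def[symmetric]
      D_def[symmetric] D'_def[symmetric] C_def[symmetric] C'_def[symmetric] chord
    by (auto simp: algebra_simps)
qed

end
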